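(* Let $f$ be a function in $\Gamma_0(\mathbb{R}^n)$, let $\alpha>0$, and let $f_\alpha := f-\mathrm{env}_{\alpha f}$. Then $f_\alpha$ is $\frac{1}{\alpha}$-semiconvex. If, in addition, $f$ is $\mu$-strongly convex (with $\mu>0$), then $f_\alpha$ is $(\mu - \frac{1}{\alpha})$-strongly convex if $\mu > \frac{1}{\alpha}$, convex if $\mu = \frac{1}{\alpha}$, and $(\frac{1}{\alpha} - \mu)$-semiconvex if $\mu< \frac{1}{\alpha}$.
   Context: Functions on $\mathbb{R}^n$ take values in $(-\infty,+\infty]$; $\|\cdot\|$ is the Euclidean norm. $\Gamma(\mathbb{R}^n)$ denotes the proper lower semicontinuous functions, and $\Gamma_0(\mathbb{R}^n)$ the proper lower semicontinuous convex functions. The Moreau envelope with parameter $\alpha>0$ is $\mathrm{env}_{\alpha f}(x)=\inf_{u\in\mathbb{R}^n}\{f(u)+\frac{1}{2\alpha}\|u-x\|^2\}$. For $\sigma>0$, $g\in\Gamma_0(\mathbb{R}^n)$ is $\sigma$-strongly convex if $g-\frac{\sigma}{2}\|\cdot\|^2$ is convex. For $\rho>0$, $g\in\Gamma(\mathbb{R}^n)$ is $\rho$-semiconvex if $g+\frac{\rho}{2}\|\cdot\|^2$ is convex. *)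

theory Defs
  imports "HOL-Analysis.Analysis"
begin

text \<open>
  Functions with values in \<open>(-\<infinity>, +\<infinity>]\<close> are \<^typ>\<open>ereal\<close>-valued functions
  that never take the value \<open>-\<infinity>\<close>. Properness and convexity both include this
  requirement; in particular the sum in the convexity inequality never has the form
  \<open>\<infinity> + (-\<infinity>)\<close>.
\<close>

definition proper_fun :: "('a \<Rightarrow> ereal) \<Rightarrow> bool" where
  "proper_fun g \<longleftrightarrow> (\<forall>x. g x \<noteq> -\<infinity>) \<and> (\<exists>x. g x \<noteq> \<infinity>)"

definition lsc_fun :: "('a::topological_space \<Rightarrow> ereal) \<Rightarrow> bool" where
  "lsc_fun g \<longleftrightarrow> (\<forall>x. g x \<le> Liminf (at x) g)"

text \<open>\<^const>\<open>convex_on\<close> is only available for real-valued functions.\<close>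

definition convex_fun :: "('a::real_vector \<Rightarrow> ereal) \<Rightarrow> bool" where
  "convex_fun g \<longleftrightarrow> (\<forall>x. g x \<noteq> -\<infinity>) \<and>
     (\<forall>x y. \<forall>t::real. 0 < t \<and> t < 1 \<longrightarrow>
        g ((1 - t) *\<^sub>R x + t *\<^sub>R y) \<le> ereal (1 - t) * g x + ereal t * g y)"

definition Gam :: "('a::topological_space \<Rightarrow> ereal) set" where
  "Gam = {g. proper_fun g \<and> lsc_fun g}"

definition Gam0 :: "('a::real_normed_vector \<Rightarrow> ereal) set" where
  "Gam0 = {g \<in> Gam. convex_fun g}"

definition moreau_env :: "real \<Rightarrow> ('a::real_normed_vector \<Rightarrow> ereal) \<Rightarrow> 'a \<Rightarrow> ereal" where
  "moreau_env \<alpha> f x = (INF u. f u + ereal (1 / (2 * \<alpha>) * (norm (u - x))\<^sup>2))"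

definition strongly_convex :: "real \<Rightarrow> ('a::real_normed_vector \<Rightarrow> ereal) \<Rightarrow> bool" where
  "strongly_convex \<sigma> g \<longleftrightarrow>
     \<sigma> > 0 \<and> g \<in> Gam0 \<and> convex_fun (\<lambda>x. g x - ereal (\<sigma> / 2 * (norm x)\<^sup>2))"

definition semiconvex :: "real \<Rightarrow> ('a::real_normed_vector \<Rightarrow> ereal) \<Rightarrow> bool" where
  "semiconvex \<rho> g \<longleftrightarrow>
     \<rho> > 0 \<and> g \<in> Gam \<and> convex_fun (\<lambda>x. g x + ereal (\<rho> / 2 * (norm x)\<^sup>2))"

text \<open>
  The function \<open>f - env\<^bsub>\<alpha>f\<^esub>\<close>. For \<open>f \<in> Gam0\<close> and \<open>\<alpha> > 0\<close> the envelope is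
  finite everywhere, so this is the pointwise difference with \<open>\<infinity> - r = \<infinity>\<close> outside the
  domain of \<open>f\<close>.
\<close>

definition env_residual :: "real \<Rightarrow> ('a::real_normed_vector \<Rightarrow> ereal) \<Rightarrow> 'a \<Rightarrow> ereal" where
  "env_residual \<alpha> f x = f x - moreau_env \<alpha> f x"

end

theory Submission
  imports Defs
begin

text \<open>
  Expanding the square in the definition of the envelope gives
  \<open>\<parallel>x\<parallel>\<^sup>2 / (2 * \<alpha>) - env\<^bsub>\<alpha>f\<^esub> x = (SUP u. (u \<bullet> x) / \<alpha> - f u - \<parallel>u\<parallel>\<^sup>2 / (2 * \<alpha>))\<close>,
  a supremum of affine functions of \<open>x\<close>. Call it \<open>h\<close>. It is convex, and
  \<open>f - env\<^bsub>\<alpha>f\<^esub> = f + h - \<parallel>\<cdot>\<parallel>\<^sup>2 / (2 * \<alpha>)\<close>. So adding \<open>\<parallel>\<cdot>\<parallel>\<^sup>2 / (2 * \<alpha>)\<close> to the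
  residual leaves \<open>f + h\<close>, a sum of convex functions; and if \<open>f - (\<mu>/2) \<parallel>\<cdot>\<parallel>\<^sup>2\<close> is convex,
  then so is the residual minus \<open>((\<mu> - 1/\<alpha>)/2) \<parallel>\<cdot>\<parallel>\<^sup>2\<close>, whatever the sign of \<open>\<mu> - 1/\<alpha>\<close>.

  What remains is analytic. The envelope has to be finite
  (\<open>moreau_env_finite\<close>), which follows from a lower bound for \<open>f\<close> that is linear in the norm
  (\<open>Gam0_linear_lower_bound\<close>) and hence dominated by the quadratic penalty. And the
  residual has to be lower semicontinuous: a finite convex function on a
  finite-dimensional space is continuous, so \<open>h\<close> and hence the envelope are continuous, and
  subtracting a continuous function preserves lower semicontinuity.
\<close>

section \<open>Lower semicontinuous and convex extended-real functions\<close>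

lemma lsc_fun_iff_eventually:
  "lsc_fun g \<longleftrightarrow> (\<forall>x. \<forall>c < g x. eventually (\<lambda>y. c < g y) (at x))"
  unfolding lsc_fun_def le_Liminf_iff by blast

lemma open_superlevel_lsc:
  fixes g :: "'a::topological_space \<Rightarrow> ereal"
  assumes "lsc_fun g"
  shows "open {x. c < g x}"
proof (subst open_subopen, intro ballI)
  fix x assume "x \<in> {x. c < g x}"
  then have cx: "c < g x" by simp
  then have "eventually (\<lambda>y. c < g y) (at x)"
    using assms lsc_fun_iff_eventually by blast
  then obtain S where S: "open S" "x \<in> S" "\<forall>y\<in>S. y \<noteq> x \<longrightarrow> c < g y"
    unfolding eventually_at_topological by auto
  then have "S \<subseteq> {x. c < g x}" using cx by auto
  with S show "\<exists>T. open T \<and> x \<in> T \<and> T \<subseteq> {x. c < g x}" by (intro exI[of _ S]) simp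
qed

text \<open>
  The open sets on which \<open>g > -n\<close> increase with \<open>n\<close> and exhaust the space, so one of them
  already contains the compact set.
\<close>

lemma lsc_bounded_below_on_compact:
  fixes g :: "'a::topological_space \<Rightarrow> ereal"
  assumes "lsc_fun g" "\<And>x. g x \<noteq> -\<infinity>" "compact K"
  obtains M :: real where "M \<ge> 0" "\<And>x. x \<in> K \<Longrightarrow> ereal (- M) < g x"
proof -
  let ?U = "\<lambda>n::nat. {x. ereal (- real n) < g x}"
  have "K \<subseteq> (\<Union>n\<in>UNIV. ?U n)"
  proof
    fix x
    obtain n :: nat where "ereal (- real n) < g x"
    proof (cases "g x")
      case (real r)
      obtain n :: nat where "- r < real n" using reals_Archimedean2 by blast
      then show ?thesis using real by (intro that[of n]) auto
    qed (use assms(2)[of x] that[of 0] in auto)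
    then show "x \<in> (\<Union>n\<in>UNIV. ?U n)" by blast
  qed
  then obtain N where N: "finite N" "K \<subseteq> (\<Union>n\<in>N. ?U n)"
    by (rule compactE_image[OF assms(3) open_superlevel_lsc[OF assms(1)]])
  show ?thesis
  proof (rule that[of "real (Max (insert 0 N))"])
    fix x assume "x \<in> K"
    then obtain n where n: "n \<in> N" "ereal (- real n) < g x" using N by blast
    have "n \<le> Max (insert 0 N)" using n N by simp
    then have "ereal (- real (Max (insert 0 N))) \<le> ereal (- real n)" by simp
    then show "ereal (- real (Max (insert 0 N))) < g x" using n by order
  qed simp
qed

lemma lsc_diff_continuous:
  fixes g :: "'a::topological_space \<Rightarrow> ereal" and e :: "'a \<Rightarrow> real"
  assumes "lsc_fun g" "continuous_on UNIV e"
  shows "lsc_fun (\<lambda>x. g x - ereal (e x))"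
  unfolding lsc_fun_iff_eventually
proof (intro allI impI)
  fix x c assume "c < g x - ereal (e x)"
  then obtain b :: real where b: "c < ereal b" "ereal b < g x - ereal (e x)"
    using ereal_dense2 by blast
  then have "ereal (b + e x) < g x"
    by (cases "g x") auto
  then obtain d :: real where d: "ereal (b + e x) < ereal d" "ereal d < g x"
    using ereal_dense2 by blast
  have "(e \<longlongrightarrow> e x) (at x)"
    using assms(2) by (simp add: continuous_on_def)
  then have "eventually (\<lambda>y. e y < d - b) (at x)"
    by (rule order_tendstoD(2)) (use d in simp)
  moreover have "eventually (\<lambda>y. ereal d < g y) (at x)"
    using assms(1) d lsc_fun_iff_eventually by blast
  ultimately show "eventually (\<lambda>y. c < g y - ereal (e y)) (at x)"
  proof eventually_elim
    case (elim y)
    then have "ereal b < g y - ereal (e y)" by (cases "g y") auto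
    then show ?case using b by order
  qed
qed

lemma convex_fun_add_real:
  fixes g :: "'a::real_vector \<Rightarrow> ereal" and h :: "'a \<Rightarrow> real"
  assumes "convex_fun g" "convex_on UNIV h"
  shows "convex_fun (\<lambda>x. g x + ereal (h x))"
  unfolding convex_fun_def
proof (intro conjI allI impI)
  fix x show "g x + ereal (h x) \<noteq> -\<infinity>"
    using assms(1) by (auto simp: convex_fun_def)
next
  fix x y :: 'a and t :: real assume t: "0 < t \<and> t < 1"
  let ?z = "(1 - t) *\<^sub>R x + t *\<^sub>R y"
  have "g ?z \<le> ereal (1 - t) * g x + ereal t * g y"
    using assms(1) t by (simp add: convex_fun_def)
  moreover have "h ?z \<le> (1 - t) * h x + t * h y"
    using convex_onD[OF assms(2), of t x y] t by simp
  ultimately have "g ?z + ereal (h ?z)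
      \<le> (ereal (1 - t) * g x + ereal t * g y) + ereal ((1 - t) * h x + t * h y)"
    by (intro add_mono) auto
  also have "\<dots> = ereal (1 - t) * (g x + ereal (h x)) + ereal t * (g y + ereal (h y))"
    using assms(1) t
    by (cases "g x"; cases "g y") (auto simp: convex_fun_def algebra_simps)
  finally show "g ?z + ereal (h ?z)
      \<le> ereal (1 - t) * (g x + ereal (h x)) + ereal t * (g y + ereal (h y))" .
qed

lemma norm_square_convex_combination:
  fixes x y :: "'a::real_inner"
  shows "(norm ((1 - t) *\<^sub>R x + t *\<^sub>R y))\<^sup>2
    = (1 - t) * (norm x)\<^sup>2 + t * (norm y)\<^sup>2 - t * (1 - t) * (norm (x - y))\<^sup>2"
  unfolding power2_norm_eq_inner by (simp add: inner_simps inner_commute algebra_simps)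

lemma convex_on_norm_square:
  assumes "c \<ge> 0"
  shows "convex_on UNIV (\<lambda>x::'a::real_inner. c * (norm x)\<^sup>2)"
proof (rule convex_onI)
  fix t :: real and x y :: 'a assume t: "0 < t" "t < 1"
  have "0 \<le> c * (t * (1 - t) * (norm (x - y))\<^sup>2)" using t assms by simp
  then show "c * (norm ((1 - t) *\<^sub>R x + t *\<^sub>R y))\<^sup>2
      \<le> (1 - t) * (c * (norm x)\<^sup>2) + t * (c * (norm y)\<^sup>2)"
    unfolding norm_square_convex_combination by (simp add: algebra_simps)
qed simp

section \<open>The Moreau envelope\<close>

text \<open>
  Fix \<open>x0\<close> in the domain. Within distance 1 of \<open>x0\<close> compactness bounds \<open>f\<close> from below. For \<open>u\<close>
  at distance \<open>r > 1\<close>, the point at distance 1 on the segment from \<open>x0\<close> to \<open>u\<close> has weight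
  \<open>1/r\<close> on \<open>u\<close>, so convexity turns the bound there into one for \<open>f u\<close> that decreases
  at most linearly in \<open>r\<close>.
\<close>

lemma Gam0_linear_lower_bound:
  fixes f :: "'a::euclidean_space \<Rightarrow> ereal"
  assumes "f \<in> Gam0"
  obtains x0 and K :: real where "K \<ge> 0" "\<And>u. ereal (- K * (1 + norm (u - x0))) \<le> f u"
proof -
  have f: "\<And>x. f x \<noteq> -\<infinity>" "lsc_fun f" "convex_fun f"
    using assms by (auto simp: Gam0_def Gam_def proper_fun_def)
  obtain x0 where "f x0 \<noteq> \<infinity>" using assms by (auto simp: Gam0_def Gam_def proper_fun_def)
  then obtain c where c: "f x0 = ereal c" using f(1)[of x0] by (cases "f x0") auto
  obtain M where M: "M \<ge> 0" "\<And>x. x \<in> cball x0 1 \<Longrightarrow> ereal (- M) < f x"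
    using lsc_bounded_below_on_compact[OF f(2,1) compact_cball] by blast
  show ?thesis
  proof (rule that[of "M + \<bar>c\<bar>" x0])
    fix u
    define r where "r = norm (u - x0)"
    show "ereal (- (M + \<bar>c\<bar>) * (1 + norm (u - x0))) \<le> f u"
    proof (cases "r \<le> 1")
      case True
      then have "ereal (- M) < f u" by (intro M) (simp add: r_def dist_norm norm_minus_commute)
      moreover have "- (M + \<bar>c\<bar>) * (1 + r) \<le> - M"
      proof -
        have "M * r \<ge> 0" "\<bar>c\<bar> * r \<ge> 0" using M by (auto simp: r_def)
        then show ?thesis by (simp add: algebra_simps)
      qed
      then have "ereal (- (M + \<bar>c\<bar>) * (1 + r)) \<le> ereal (- M)" by simp
      ultimately show ?thesis unfolding r_def by order
    next
      case False
      then have r: "r > 1" by simp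
      define y where "y = (1 - 1/r) *\<^sub>R x0 + (1/r) *\<^sub>R u"
      have "y - x0 = (1/r) *\<^sub>R (u - x0)" by (simp add: y_def algebra_simps)
      then have "norm (y - x0) = 1" using r by (auto simp: r_def)
      then have "y \<in> cball x0 1" by (simp add: dist_norm norm_minus_commute)
      then have 1: "ereal (- M) < f y" by (rule M)
      have 2: "f y \<le> ereal (1 - 1/r) * f x0 + ereal (1/r) * f u"
        unfolding y_def using f(3) r by (simp add: convex_fun_def)
      show ?thesis
      proof (cases "f u")
        case (real b)
        have "ereal (- M) < ereal ((1 - 1/r) * c + (1/r) * b)"
          using less_le_trans[OF 1 2] c real by simp
        then have "r * (- M) < r * ((1 - 1/r) * c + (1/r) * b)"
          using r by (intro mult_strict_left_mono) simp_all
        also have "\<dots> = (r - 1) * c + b"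
          using r by (simp add: field_simps)
        finally have "- M * r - (r - 1) * c < b" by (simp add: algebra_simps)
        moreover have "(r - 1) * c \<le> (r - 1) * \<bar>c\<bar>" using r by (intro mult_left_mono) auto
        ultimately have "- (M + \<bar>c\<bar>) * (1 + r) \<le> b" using M by (simp add: algebra_simps)
        then show ?thesis using real by (simp add: r_def)
      qed (use f(1)[of u] in auto)
    qed
  qed (use M in auto)
qed

lemma moreau_env_finite:
  fixes f :: "'a::euclidean_space \<Rightarrow> ereal"
  assumes "f \<in> Gam0" "\<alpha> > 0"
  shows "\<bar>moreau_env \<alpha> f x\<bar> \<noteq> \<infinity>"
proof -
  obtain x0 where x0: "f x0 \<noteq> \<infinity>" using assms by (auto simp: Gam0_def Gam_def proper_fun_def)
  have "moreau_env \<alpha> f x \<le> f x0 + ereal (1 / (2 * \<alpha>) * (norm (x0 - x))\<^sup>2)"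
    unfolding moreau_env_def by (rule INF_lower) simp
  then have upper: "moreau_env \<alpha> f x \<noteq> \<infinity>" using x0 by auto
  obtain z and K :: real where K: "K \<ge> 0" "\<And>u. ereal (- K * (1 + norm (u - z))) \<le> f u"
    by (rule Gam0_linear_lower_bound[OF assms(1)]) (rule that; assumption)
  define B where "B = - K * (1 + norm (x - z)) - \<alpha> * K\<^sup>2 / 2"
  have "ereal B \<le> moreau_env \<alpha> f x"
    unfolding moreau_env_def
  proof (rule INF_greatest)
    fix u
    define s where "s = norm (u - x)"
    have "norm (u - z) \<le> s + norm (x - z)"
      unfolding s_def using norm_triangle_ineq[of "u - x" "x - z"] by simp
    then have "K * norm (u - z) \<le> K * (s + norm (x - z))"
      using K by (intro mult_left_mono)
    \<comment> \<open>completing the square in \<open>s\<close> bounds the linear term by the penalty\<close>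
    moreover have "1 / (2 * \<alpha>) * (s - \<alpha> * K)\<^sup>2 \<ge> 0" using assms by simp
    moreover have "1 / (2 * \<alpha>) * (s - \<alpha> * K)\<^sup>2
        = 1 / (2 * \<alpha>) * s\<^sup>2 - K * s + \<alpha> * K\<^sup>2 / 2"
      using assms by (simp add: power2_eq_square field_simps)
    ultimately have "B \<le> - K * (1 + norm (u - z)) + 1 / (2 * \<alpha>) * s\<^sup>2"
      by (simp add: B_def algebra_simps)
    then have "ereal B \<le> ereal (- K * (1 + norm (u - z))) + ereal (1 / (2 * \<alpha>) * s\<^sup>2)"
      by simp
    also have "\<dots> \<le> f u + ereal (1 / (2 * \<alpha>) * s\<^sup>2)"
      by (intro add_right_mono K)
    finally show "ereal B \<le> f u + ereal (1 / (2 * \<alpha>) * (norm (u - x))\<^sup>2)"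
      by (simp add: s_def)
  qed
  then show ?thesis using upper by auto
qed

text \<open>
  This is the convexity of the supremum of affine functions, read off from the envelope
  itself. For fixed \<open>u\<close>, the penalty \<open>\<parallel>u - x\<parallel>\<^sup>2\<close> and \<open>\<parallel>x\<parallel>\<^sup>2\<close> have the same
  defect \<open>t (1 - t) \<parallel>x - y\<parallel>\<^sup>2\<close> from being affine along a segment, so it cancels in the difference.
\<close>

lemma convex_norm_square_minus_moreau_env:
  fixes f :: "'a::real_inner \<Rightarrow> ereal"
  assumes fin: "\<And>x. moreau_env \<alpha> f x = ereal (e x)" and f: "\<And>x. f x \<noteq> -\<infinity>"
  shows "convex_on UNIV (\<lambda>x. 1 / (2 * \<alpha>) * (norm x)\<^sup>2 - e x)"
proof (rule convex_onI)
  fix t :: real and x y :: 'a assume t: "0 < t" "t < 1"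
  define z where "z = (1 - t) *\<^sub>R x + t *\<^sub>R y"
  define a where "a = 1 / (2 * \<alpha>)"
  define D where "D = a * (t * (1 - t) * (norm (x - y))\<^sup>2)"
  have e_le: "ereal (e w) \<le> f u + ereal (a * (norm (u - w))\<^sup>2)" for w u
    unfolding fin[symmetric] moreau_env_def a_def by (rule INF_lower) simp
  have "ereal ((1 - t) * e x + t * e y - D) \<le> moreau_env \<alpha> f z"
    unfolding moreau_env_def a_def[symmetric]
  proof (rule INF_greatest)
    fix u
    show "ereal ((1 - t) * e x + t * e y - D) \<le> f u + ereal (a * (norm (u - z))\<^sup>2)"
    proof (cases "f u")
      case (real b)
      have "(1 - t) * e x \<le> (1 - t) * (b + a * (norm (u - x))\<^sup>2)"
           "t * e y \<le> t * (b + a * (norm (u - y))\<^sup>2)"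
        using e_le[of x u] e_le[of y u] real t by (auto intro: mult_left_mono)
      moreover have "u - z = (1 - t) *\<^sub>R (u - x) + t *\<^sub>R (u - y)"
        by (simp add: z_def algebra_simps)
      then have sq: "(norm (u - z))\<^sup>2 = (1 - t) * (norm (u - x))\<^sup>2 + t * (norm (u - y))\<^sup>2
          - t * (1 - t) * (norm (x - y))\<^sup>2"
        using norm_square_convex_combination[of t "u - x" "u - y"]
        by (simp add: norm_minus_commute)
      have "a * (norm (u - z))\<^sup>2
          = (1 - t) * (a * (norm (u - x))\<^sup>2) + t * (a * (norm (u - y))\<^sup>2) - D"
        unfolding sq D_def by (simp add: algebra_simps)
      ultimately have "(1 - t) * e x + t * e y - D \<le> b + a * (norm (u - z))\<^sup>2"
        by (simp add: algebra_simps)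
      then show ?thesis using real by simp
    qed (use f[of u] in auto)
  qed
  then have "(1 - t) * e x + t * e y - D \<le> e z" by (simp add: fin)
  moreover have "a * (norm z)\<^sup>2 = (1 - t) * (a * (norm x)\<^sup>2) + t * (a * (norm y)\<^sup>2) - D"
    unfolding z_def norm_square_convex_combination D_def by (simp add: algebra_simps)
  ultimately show "1 / (2 * \<alpha>) * (norm ((1 - t) *\<^sub>R x + t *\<^sub>R y))\<^sup>2 - e ((1 - t) *\<^sub>R x + t *\<^sub>R y)
      \<le> (1 - t) * (1 / (2 * \<alpha>) * (norm x)\<^sup>2 - e x) + t * (1 / (2 * \<alpha>) * (norm y)\<^sup>2 - e y)"
    unfolding z_def[symmetric] a_def[symmetric] by (simp add: algebra_simps)
qed simp

section \<open>The residual\<close>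

lemma env_residual_decomposition:
  fixes f :: "'a::euclidean_space \<Rightarrow> ereal"
  assumes "f \<in> Gam0" "\<alpha> > 0"
  obtains h where "convex_on UNIV h" "continuous_on UNIV h"
    "\<And>x. env_residual \<alpha> f x = f x - ereal (1 / (2 * \<alpha>) * (norm x)\<^sup>2 - h x)"
proof -
  define e where "e x = real_of_ereal (moreau_env \<alpha> f x)" for x
  define h where "h x = 1 / (2 * \<alpha>) * (norm x)\<^sup>2 - e x" for x
  have e: "moreau_env \<alpha> f x = ereal (e x)" for x
    unfolding e_def using moreau_env_finite[OF assms] by (simp add: ereal_real')
  have convex: "convex_on UNIV h"
    unfolding h_def by (rule convex_norm_square_minus_moreau_env[OF e])
      (use assms in \<open>auto simp: Gam0_def Gam_def proper_fun_def\<close>)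
  have "continuous_on UNIV h"
    by (rule convex_on_continuous[OF open_UNIV convex])
  moreover have "env_residual \<alpha> f x = f x - ereal (1 / (2 * \<alpha>) * (norm x)\<^sup>2 - h x)" for x
    by (simp add: env_residual_def e h_def)
  ultimately show ?thesis using convex that by blast
qed

lemma env_residual_in_Gam:
  fixes f :: "'a::euclidean_space \<Rightarrow> ereal"
  assumes "f \<in> Gam0" "\<alpha> > 0"
  shows "env_residual \<alpha> f \<in> Gam"
proof -
  obtain h where h: "continuous_on UNIV h"
    "\<And>x. env_residual \<alpha> f x = f x - ereal (1 / (2 * \<alpha>) * (norm x)\<^sup>2 - h x)"
    by (rule env_residual_decomposition[OF assms]) (rule that; assumption)
  have "lsc_fun f" "proper_fun f" using assms by (auto simp: Gam0_def Gam_def)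
  have "lsc_fun (env_residual \<alpha> f)"
    unfolding h(2)[abs_def] using \<open>lsc_fun f\<close>
    by (rule lsc_diff_continuous) (intro continuous_intros h(1))
  moreover have "proper_fun (env_residual \<alpha> f)"
    using \<open>proper_fun f\<close> unfolding proper_fun_def h(2)
    by (simp add: minus_ereal_def)
  ultimately show ?thesis by (simp add: Gam_def)
qed

text \<open>
  The convexity claims of the proposition are all instances of this fact, with \<open>\<mu> = 0\<close> for a function
  that is merely convex. The modulus \<open>\<mu> - 1/\<alpha>\<close> may have either sign.
\<close>

lemma convex_env_residual_shifted:
  fixes f :: "'a::euclidean_space \<Rightarrow> ereal"
  assumes "f \<in> Gam0" "\<alpha> > 0" and mu: "convex_fun (\<lambda>x. f x - ereal (\<mu> / 2 * (norm x)\<^sup>2))"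
  shows "convex_fun (\<lambda>x. env_residual \<alpha> f x - ereal ((\<mu> - 1 / \<alpha>) / 2 * (norm x)\<^sup>2))"
proof -
  obtain h where h: "convex_on UNIV h"
    "\<And>x. env_residual \<alpha> f x = f x - ereal (1 / (2 * \<alpha>) * (norm x)\<^sup>2 - h x)"
    by (rule env_residual_decomposition[OF assms(1,2)]) (rule that; assumption)
  have "env_residual \<alpha> f x - ereal ((\<mu> - 1 / \<alpha>) / 2 * (norm x)\<^sup>2)
      = (f x - ereal (\<mu> / 2 * (norm x)\<^sup>2)) + ereal (h x)" for x
    unfolding h(2) by (cases "f x") (auto simp: field_simps)
  then show ?thesis using convex_fun_add_real[OF mu h(1)] by simp
qed

theorem proposition2:
  fixes f :: "real ^ 'n \<Rightarrow> ereal" and \<alpha> :: real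
  assumes "f \<in> Gam0" and "\<alpha> > 0"
  shows "semiconvex (1 / \<alpha>) (env_residual \<alpha> f) \<and>
    (\<forall>\<mu>::real. \<mu> > 0 \<and> strongly_convex \<mu> f \<longrightarrow>
       (\<mu> > 1 / \<alpha> \<longrightarrow> strongly_convex (\<mu> - 1 / \<alpha>) (env_residual \<alpha> f)) \<and>
       (\<mu> = 1 / \<alpha> \<longrightarrow> convex_fun (env_residual \<alpha> f)) \<and>
       (\<mu> < 1 / \<alpha> \<longrightarrow> semiconvex (1 / \<alpha> - \<mu>) (env_residual \<alpha> f)))"
proof (intro conjI allI impI)
  have semiconvexI: "semiconvex \<rho> (env_residual \<alpha> f)"
    if "\<rho> > 0" "convex_fun (\<lambda>x. env_residual \<alpha> f x - ereal ((- \<rho>) / 2 * (norm x)\<^sup>2))" for \<rho>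
    using that env_residual_in_Gam[OF assms] by (simp add: semiconvex_def minus_ereal_def)
  have "convex_fun f" using assms by (simp add: Gam0_def)
  then show "semiconvex (1 / \<alpha>) (env_residual \<alpha> f)"
    using convex_env_residual_shifted[OF assms, of 0] assms
    by (intro semiconvexI) (simp_all add: zero_ereal_def[symmetric])
  fix \<mu> :: real
  assume "\<mu> > 0 \<and> strongly_convex \<mu> f"
  then have shifted:
    "convex_fun (\<lambda>x. env_residual \<alpha> f x - ereal ((\<mu> - 1 / \<alpha>) / 2 * (norm x)\<^sup>2))"
    by (intro convex_env_residual_shifted assms) (simp add: strongly_convex_def)
  show "convex_fun (env_residual \<alpha> f)" if "\<mu> = 1 / \<alpha>"
    using shifted that by (simp add: zero_ereal_def[symmetric])
  show "semiconvex (1 / \<alpha> - \<mu>) (env_residual \<alpha> f)" if "\<mu> < 1 / \<alpha>"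
    using shifted that by (intro semiconvexI) simp_all
  assume gt: "\<mu> > 1 / \<alpha>"
  let ?q = "\<lambda>x::real ^ 'n. (\<mu> - 1 / \<alpha>) / 2 * (norm x)\<^sup>2"
  have "convex_fun (\<lambda>x. (env_residual \<alpha> f x - ereal (?q x)) + ereal (?q x))"
    using shifted gt by (intro convex_fun_add_real convex_on_norm_square) simp_all
  moreover have "(env_residual \<alpha> f x - ereal (?q x)) + ereal (?q x) = env_residual \<alpha> f x" for x
    by (cases "env_residual \<alpha> f x") auto
  ultimately have "convex_fun (env_residual \<alpha> f)" by simp
  then show "strongly_convex (\<mu> - 1 / \<alpha>) (env_residual \<alpha> f)"
    using shifted gt env_residual_in_Gam[OF assms] by (simp add: strongly_convex_def Gam0_def)
qed

end
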